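(* (a) For every $m\ge1$, the toroidal $(1,m)$-grid is periodic at time $m$; if $m=2\ell$ is even, then for every $i\in\mathbb{Z}_m$ there is perfect state transfer from vertex $(0,i)$ to vertex $(0,i+\ell)$ at time $\ell$. (b) For the toroidal $(2,m)$-grid: if $m$ is even, the map is periodic at time $m$; if $m$ is odd, then for every $i\in\mathbb{Z}_m$ there is perfect state transfer from vertex $(0,i)$ to vertex $(1,i)$ at time $m$, and the map is periodic at time $2m$.
   Context: For positive integers $n,m$, the toroidal $(n,m)$-grid is the orientable map (of genus 1) with vertex set $\mathbb{Z}_n\times\mathbb{Z}_m$ and edge set $\{w_R,w_D: w\in \mathbb{Z}_n\times\mathbb{Z}_m\}$, where $(a,b)_R$ joins $(a,b)$ and $(a,b+1)$ and $(a,b)_D$ joins $(a,b)$ and $(a+1,b)$ (indices modulo $n$ and $m$; edges may be loops or parallel), and the clockwise rotation at $(a,b)$ is $((a,b)_R,(a,b)_D,(a,b-1)_R,(a-1,b)_D)$. For an orientable map with vertex set $V$ and face set $F$: each edge gives two arcs on opposite sides, pointing in opposite directions, each lying in a face and oriented along its clockwise facial walk; $\mathcal A$ is the arc set, $v(a)$, $f(a)$ the tail vertex and face of $a$; $N\in\{0,1\}^{\mathcal A\times V}$ with $N(a,w)=1$ iff $w=v(a)$, $M\in\{0,1\}^{\mathcal A\times F}$ with $M(a,f)=1$ iff $f=f(a)$, $D=N^TN$, $\Delta=M^TM$, $\hat N=ND^{-1/2}$, $\hat M=M\Delta^{-1/2}$, $Q=\hat N\hat N^T$, $P=\hat M\hat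 M^T$, $U=(2P-I)(2Q-I)$. For distinct vertices $u,v$ of equal degree there is perfect state transfer from $u$ to $v$ at time $\tau$ if $U^\tau\hat Ne_u=\hat Ne_v$ ($e_w$ the standard basis vector of $\mathbb{C}^V$); the map is periodic at time $\tau$ if $U^\tau\hat N=\hat N$. *)

theory Defs
  imports Complex_Main "HOL-Combinatorics.Cycles" "HOL-Combinatorics.Orbits"
begin

section \<open>Orientable maps as rotation systems\<close>

text \<open>
  An edge \<open>e\<close> carries the two arcs \<open>Fwd e\<close> (from \<open>src e\<close> to \<open>tgt e\<close>) and \<open>Bwd e\<close>
  (from \<open>tgt e\<close> to \<open>src e\<close>).  This also distinguishes the two arcs, and the two ends, of a loop:
  the occurrence of \<open>e\<close> in a rotation as \<open>Fwd e\<close> is its \<open>src\<close> end, as \<open>Bwd e\<close> its \<open>tgt\<close> end.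
\<close>

datatype 'e arc = Fwd 'e | Bwd 'e

fun opp :: "'e arc \<Rightarrow> 'e arc" where
  "opp (Fwd e) = Bwd e"
| "opp (Bwd e) = Fwd e"

record ('v, 'e) rotation_system =
  verts :: "'v set"
  edges :: "'e set"
  src :: "'e \<Rightarrow> 'v"
  tgt :: "'e \<Rightarrow> 'v"
  rotation :: "'v \<Rightarrow> 'e arc list"  \<comment> \<open>clockwise cyclic order of the arcs leaving a vertex\<close>

definition arcs :: "('v, 'e) rotation_system \<Rightarrow> 'e arc set" where
  "arcs G = Fwd ` edges G \<union> Bwd ` edges G"

fun tail :: "('v, 'e) rotation_system \<Rightarrow> 'e arc \<Rightarrow> 'v" where
  "tail G (Fwd e) = src G e"
| "tail G (Bwd e) = tgt G e"

definition head :: "('v, 'e) rotation_system \<Rightarrow> 'e arc \<Rightarrow> 'v" where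
  "head G a = tail G (opp a)"

definition degree :: "('v, 'e) rotation_system \<Rightarrow> 'v \<Rightarrow> nat" where
  "degree G v = card {a \<in> arcs G. tail G a = v}"

locale orientable_map =
  fixes G :: "('v, 'e) rotation_system"
  assumes finite_verts: "finite (verts G)"
    and finite_edges: "finite (edges G)"
    and nonempty: "edges G \<noteq> {}"
    and src_in: "e \<in> edges G \<Longrightarrow> src G e \<in> verts G"
    and tgt_in: "e \<in> edges G \<Longrightarrow> tgt G e \<in> verts G"
    and distinct_rotation: "v \<in> verts G \<Longrightarrow> distinct (rotation G v)"
    and set_rotation: "v \<in> verts G \<Longrightarrow> set (rotation G v) = {a \<in> arcs G. tail G a = v}"
    and connected: "u \<in> verts G \<Longrightarrow> v \<in> verts G \<Longrightarrow>
      (u, v) \<in> {(tail G a, head G a) | a. a \<in> arcs G}\<^sup>*"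

text \<open>
  A clockwise facial walk has its face on the right.  Having arrived along \<open>a\<close> at \<open>head G a\<close>, it
  therefore leaves along the arc that comes immediately before \<open>opp a\<close> in the clockwise order
  there.  Each arc lies in the face to its right, and a face is identified with its set of arcs.
\<close>

definition next_arc :: "('v, 'e) rotation_system \<Rightarrow> 'e arc \<Rightarrow> 'e arc" where
  "next_arc G a = inv (cycle_of_list (rotation G (head G a))) (opp a)"

definition face_of :: "('v, 'e) rotation_system \<Rightarrow> 'e arc \<Rightarrow> 'e arc set" where
  "face_of G a = orbit (next_arc G) a"

definition faces :: "('v, 'e) rotation_system \<Rightarrow> 'e arc set set" where
  "faces G = face_of G ` arcs G"

definition euler_characteristic :: "('v, 'e) rotation_system \<Rightarrow> int" where
  "euler_characteristic G = int (card (verts G)) - int (card (edges G)) + int (card (faces G))"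


section \<open>Complex matrices over finite index sets\<close>

text \<open>
  An \<open>I \<times> J\<close> matrix is a function of which only the values on \<open>I \<times> J\<close> matter; a vector over \<open>I\<close>
  likewise.
\<close>

type_synonym ('i, 'j) cmat = "'i \<Rightarrow> 'j \<Rightarrow> complex"

definition mmul :: "'j set \<Rightarrow> ('i, 'j) cmat \<Rightarrow> ('j, 'k) cmat \<Rightarrow> ('i, 'k) cmat" where
  "mmul J A B = (\<lambda>i k. \<Sum>j\<in>J. A i j * B j k)"

definition mvec :: "'j set \<Rightarrow> ('i, 'j) cmat \<Rightarrow> ('j \<Rightarrow> complex) \<Rightarrow> 'i \<Rightarrow> complex" where
  "mvec J A x = (\<lambda>i. \<Sum>j\<in>J. A i j * x j)"

definition mtranspose :: "('i, 'j) cmat \<Rightarrow> ('j, 'i) cmat" where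
  "mtranspose A = (\<lambda>j i. A i j)"

definition mone :: "('i, 'i) cmat" where
  "mone = (\<lambda>i j. if i = j then 1 else 0)"

definition reflection :: "('i, 'i) cmat \<Rightarrow> ('i, 'i) cmat" where
  "reflection A = (\<lambda>i j. 2 * A i j - mone i j)"

primrec mpow :: "'i set \<Rightarrow> ('i, 'i) cmat \<Rightarrow> nat \<Rightarrow> ('i, 'i) cmat" where
  "mpow I A 0 = mone"
| "mpow I A (Suc k) = mmul I A (mpow I A k)"

definition unit_vec :: "'i \<Rightarrow> 'i \<Rightarrow> complex" where
  "unit_vec w = (\<lambda>i. if i = w then 1 else 0)"

text \<open>The power \<open>D\<^sup>-\<^sup>1\<^sup>/\<^sup>2\<close> of a diagonal matrix \<open>D\<close> with positive diagonal entries.\<close>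

definition diag_inv_sqrt :: "('i, 'i) cmat \<Rightarrow> ('i, 'i) cmat" where
  "diag_inv_sqrt D = (\<lambda>i j. if i = j then complex_of_real (1 / sqrt (Re (D i i))) else 0)"

lemma diag_inv_sqrt_correct:
  assumes "finite I"
    and diag: "\<And>i j. i \<in> I \<Longrightarrow> j \<in> I \<Longrightarrow> i \<noteq> j \<Longrightarrow> D i j = 0"
    and pos: "\<And>i. i \<in> I \<Longrightarrow> D i i = complex_of_real (d i) \<and> d i > 0"
    and "i \<in> I" "j \<in> I"
  shows "mmul I (mmul I (diag_inv_sqrt D) (diag_inv_sqrt D)) D i j = mone i j"
proof -
  have sq: "mmul I (diag_inv_sqrt D) (diag_inv_sqrt D) i k
      = (if i = k then complex_of_real (1 / d i) else 0)" for k
  proof -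
    have "mmul I (diag_inv_sqrt D) (diag_inv_sqrt D) i k
        = (\<Sum>l\<in>I. if l = i then diag_inv_sqrt D i i * diag_inv_sqrt D i k else 0)"
      unfolding mmul_def by (rule sum.cong) (auto simp: diag_inv_sqrt_def)
    also have "\<dots> = diag_inv_sqrt D i i * diag_inv_sqrt D i k"
      using assms(1,4) by simp
    also have "\<dots> = (if i = k then complex_of_real (1 / d i) else 0)"
      using pos[OF \<open>i \<in> I\<close>] by (auto simp: diag_inv_sqrt_def simp flip: of_real_mult)
    finally show ?thesis .
  qed
  have "mmul I (mmul I (diag_inv_sqrt D) (diag_inv_sqrt D)) D i j
      = (\<Sum>k\<in>I. if k = i then complex_of_real (1 / d i) * D i j else 0)"
    unfolding mmul_def[of I "mmul _ _ _"] by (rule sum.cong) (auto simp: sq)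
  also have "\<dots> = complex_of_real (1 / d i) * D i j"
    using assms(1,4) by simp
  also have "\<dots> = mone i j"
    using diag[of i j] pos[OF \<open>i \<in> I\<close>] \<open>i \<in> I\<close> \<open>j \<in> I\<close>
    by (cases "i = j") (auto simp: mone_def)
  finally show ?thesis .
qed


section \<open>The vertex-face walk\<close>

definition N_mat :: "('v, 'e) rotation_system \<Rightarrow> ('e arc, 'v) cmat" where
  "N_mat G = (\<lambda>a w. if w = tail G a then 1 else 0)"

definition M_mat :: "('v, 'e) rotation_system \<Rightarrow> ('e arc, 'e arc set) cmat" where
  "M_mat G = (\<lambda>a f. if f = face_of G a then 1 else 0)"

definition D_mat :: "('v, 'e) rotation_system \<Rightarrow> ('v, 'v) cmat" where
  "D_mat G = mmul (arcs G) (mtranspose (N_mat G)) (N_mat G)"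

definition Delta_mat :: "('v, 'e) rotation_system \<Rightarrow> ('e arc set, 'e arc set) cmat" where
  "Delta_mat G = mmul (arcs G) (mtranspose (M_mat G)) (M_mat G)"

definition Nhat :: "('v, 'e) rotation_system \<Rightarrow> ('e arc, 'v) cmat" where
  "Nhat G = mmul (verts G) (N_mat G) (diag_inv_sqrt (D_mat G))"

definition Mhat :: "('v, 'e) rotation_system \<Rightarrow> ('e arc, 'e arc set) cmat" where
  "Mhat G = mmul (faces G) (M_mat G) (diag_inv_sqrt (Delta_mat G))"

definition Q_mat :: "('v, 'e) rotation_system \<Rightarrow> ('e arc, 'e arc) cmat" where
  "Q_mat G = mmul (verts G) (Nhat G) (mtranspose (Nhat G))"

definition P_mat :: "('v, 'e) rotation_system \<Rightarrow> ('e arc, 'e arc) cmat" where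
  "P_mat G = mmul (faces G) (Mhat G) (mtranspose (Mhat G))"

definition U_mat :: "('v, 'e) rotation_system \<Rightarrow> ('e arc, 'e arc) cmat" where
  "U_mat G = mmul (arcs G) (reflection (P_mat G)) (reflection (Q_mat G))"

definition perfect_state_transfer :: "('v, 'e) rotation_system \<Rightarrow> 'v \<Rightarrow> 'v \<Rightarrow> nat \<Rightarrow> bool" where
  "perfect_state_transfer G u v \<tau> \<longleftrightarrow>
     u \<in> verts G \<and> v \<in> verts G \<and> u \<noteq> v \<and> degree G u = degree G v \<and>
     (\<forall>a\<in>arcs G.
        mvec (arcs G) (mpow (arcs G) (U_mat G) \<tau>) (mvec (verts G) (Nhat G) (unit_vec u)) a
        = mvec (verts G) (Nhat G) (unit_vec v) a)"

definition periodic_at :: "('v, 'e) rotation_system \<Rightarrow> nat \<Rightarrow> bool" where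
  "periodic_at G \<tau> \<longleftrightarrow>
     (\<forall>a\<in>arcs G. \<forall>w\<in>verts G.
        mmul (arcs G) (mpow (arcs G) (U_mat G) \<tau>) (Nhat G) a w = Nhat G a w)"

lemma D_mat_eq:
  assumes "finite (arcs G)"
  shows "D_mat G v w = (if v = w then of_nat (degree G v) else 0)"
proof -
  have "D_mat G v w = (\<Sum>a\<in>arcs G. if v = w \<and> tail G a = v then 1 else 0)"
    unfolding D_mat_def mmul_def by (rule sum.cong) (auto simp: mtranspose_def N_mat_def)
  also have "\<dots> = (if v = w then of_nat (degree G v) else 0)"
    using assms by (simp add: degree_def sum.If_cases Int_def)
  finally show ?thesis .
qed

lemma Delta_mat_eq:
  assumes "finite (arcs G)"
  shows "Delta_mat G f g = (if f = g then of_nat (card {a \<in> arcs G. face_of G a = f}) else 0)"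
proof -
  have "Delta_mat G f g = (\<Sum>a\<in>arcs G. if f = g \<and> face_of G a = f then 1 else 0)"
    unfolding Delta_mat_def mmul_def by (rule sum.cong) (auto simp: mtranspose_def M_mat_def)
  also have "\<dots> = (if f = g then of_nat (card {a \<in> arcs G. face_of G a = f}) else 0)"
    using assms by (simp add: sum.If_cases Int_def)
  finally show ?thesis .
qed


section \<open>Toroidal grids\<close>

text \<open>
  \<open>\<int>\<^sub>n\<close> is represented by \<open>{0..<n}\<close> with arithmetic modulo \<open>n\<close>; \<open>RightE w\<close> and \<open>DownE w\<close> are
  the edges \<open>w\<^sub>R\<close> and \<open>w\<^sub>D\<close>.
\<close>

datatype grid_edge = RightE "int \<times> int" | DownE "int \<times> int"

definition grid_verts :: "nat \<Rightarrow> nat \<Rightarrow> (int \<times> int) set" where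
  "grid_verts n m = {0..<int n} \<times> {0..<int m}"

fun grid_src :: "grid_edge \<Rightarrow> int \<times> int" where
  "grid_src (RightE w) = w"
| "grid_src (DownE w) = w"

fun grid_tgt :: "nat \<Rightarrow> nat \<Rightarrow> grid_edge \<Rightarrow> int \<times> int" where
  "grid_tgt n m (RightE (a, b)) = (a, (b + 1) mod int m)"
| "grid_tgt n m (DownE (a, b)) = ((a + 1) mod int n, b)"

fun grid_rotation :: "nat \<Rightarrow> nat \<Rightarrow> int \<times> int \<Rightarrow> grid_edge arc list" where
  "grid_rotation n m (a, b) =
     [Fwd (RightE (a, b)), Fwd (DownE (a, b)),
      Bwd (RightE (a, (b - 1) mod int m)), Bwd (DownE ((a - 1) mod int n, b))]"

definition toroidal_grid :: "nat \<Rightarrow> nat \<Rightarrow> (int \<times> int, grid_edge) rotation_system" where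
  "toroidal_grid n m =
     \<lparr>verts = grid_verts n m,
      edges = RightE ` grid_verts n m \<union> DownE ` grid_verts n m,
      src = grid_src,
      tgt = grid_tgt n m,
      rotation = grid_rotation n m\<rparr>"

lemma toroidal_grid_simps:
  "verts (toroidal_grid n m) = grid_verts n m"
  "edges (toroidal_grid n m) = RightE ` grid_verts n m \<union> DownE ` grid_verts n m"
  "src (toroidal_grid n m) = grid_src"
  "tgt (toroidal_grid n m) = grid_tgt n m"
  "rotation (toroidal_grid n m) = grid_rotation n m"
  by (simp_all add: toroidal_grid_def)

lemma mod_pred_succ:
  fixes x k :: int
  assumes "0 \<le> x" "x < k"
  shows "((x - 1) mod k + 1) mod k = x" "((x + 1) mod k - 1) mod k = x"
  using assms by (simp_all add: mod_simps)

lemma mod_succ_eq_iff: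
  fixes x y k :: int
  assumes "0 \<le> x" "x < k" "0 \<le> y" "y < k"
  shows "(x + 1) mod k = y \<longleftrightarrow> x = (y - 1) mod k"
  using assms mod_pred_succ by metis

lemma toroidal_grid_connected:
  assumes "u \<in> grid_verts n m" "v \<in> grid_verts n m"
  defines "R \<equiv> {(tail (toroidal_grid n m) a, head (toroidal_grid n m) a) | a. a \<in> arcs (toroidal_grid n m)}"
  shows "(u, v) \<in> R\<^sup>*"
proof -
  have R1: "((a, b), (a, (b + 1) mod int m)) \<in> R" if "(a, b) \<in> grid_verts n m" for a b
    unfolding R_def using that
    by (auto intro!: exI[of _ "Fwd (RightE (a, b))"] simp: arcs_def head_def toroidal_grid_simps)
  have R2: "((a, b), ((a + 1) mod int n, b)) \<in> R" if "(a, b) \<in> grid_verts n m" for a b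
    unfolding R_def using that
    by (auto intro!: exI[of _ "Fwd (DownE (a, b))"] simp: arcs_def head_def toroidal_grid_simps)
  obtain a b a' b' where uv: "u = (a, b)" "v = (a', b')" by (metis surj_pair)
  have b: "0 \<le> a" "a < int n" "0 \<le> b" "b < int m" "0 \<le> a'" "a' < int n" "0 \<le> b'" "b' < int m"
    using assms(1,2) by (auto simp: uv grid_verts_def)
  have S1: "((a, b), (a, (b + int k) mod int m)) \<in> R\<^sup>*" for k
  proof (induction k)
    case 0 then show ?case using b by simp
  next
    case (Suc k)
    have "((a, (b + int k) mod int m), (a, ((b + int k) mod int m + 1) mod int m)) \<in> R"
      by (rule R1) (use b in \<open>auto simp: grid_verts_def\<close>)
    then show ?case using Suc by (simp add: mod_simps add_ac)
  qed
  have S2: "((a, b'), ((a + int k) mod int n, b')) \<in> R\<^sup>*" for k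
  proof (induction k)
    case 0 then show ?case using b by simp
  next
    case (Suc k)
    have "(((a + int k) mod int n, b'), (((a + int k) mod int n + 1) mod int n, b')) \<in> R"
      by (rule R2) (use b in \<open>auto simp: grid_verts_def\<close>)
    then show ?case using Suc by (simp add: mod_simps add_ac)
  qed
  have "((a, b), (a, b')) \<in> R\<^sup>*"
    using S1[of "nat (b' - b + int m)"] b by (simp add: mod_simps)
  moreover have "((a, b'), (a', b')) \<in> R\<^sup>*"
    using S2[of "nat (a' - a + int n)"] b by (simp add: mod_simps)
  ultimately show ?thesis unfolding uv by (rule rtrancl_trans)
qed

lemma toroidal_grid_orientable_map:
  assumes "n \<ge> 1" "m \<ge> 1"
  shows "orientable_map (toroidal_grid n m)"
proof
  let ?G = "toroidal_grid n m"
  show "finite (verts ?G)" "finite (edges ?G)"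
    by (auto simp: toroidal_grid_simps grid_verts_def)
  have "(0, 0) \<in> grid_verts n m" using assms by (simp add: grid_verts_def)
  then show "edges ?G \<noteq> {}" by (auto simp: toroidal_grid_simps)
  show "src ?G e \<in> verts ?G" "tgt ?G e \<in> verts ?G" if "e \<in> edges ?G" for e
    using that by (auto simp: toroidal_grid_simps grid_verts_def)
  show "distinct (rotation ?G v)" if "v \<in> verts ?G" for v
    by (cases v) (auto simp: toroidal_grid_simps)
  show "set (rotation ?G v) = {a \<in> arcs ?G. tail ?G a = v}" if "v \<in> verts ?G" for v
  proof -
    obtain a b where v: "v = (a, b)" by (cases v)
    have b: "0 \<le> a" "a < int n" "0 \<le> b" "b < int m"
      using that by (auto simp: v toroidal_grid_simps grid_verts_def)
    have "x \<in> set (rotation ?G v) \<longleftrightarrow> x \<in> arcs ?G \<and> tail ?G x = v" for x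
    proof -
      consider c d where "x = Fwd (RightE (c, d))" | c d where "x = Fwd (DownE (c, d))"
        | c d where "x = Bwd (RightE (c, d))" | c d where "x = Bwd (DownE (c, d))"
        by (metis arc.exhaust grid_edge.exhaust surj_pair)
      then show ?thesis
        using b by cases
          (auto simp: v arcs_def toroidal_grid_simps grid_verts_def mod_succ_eq_iff mod_pred_succ)
    qed
    then show ?thesis by blast
  qed
  show "(u, v) \<in> {(tail ?G a, head ?G a) | a. a \<in> arcs ?G}\<^sup>*" if "u \<in> verts ?G" "v \<in> verts ?G" for u v
    using that toroidal_grid_connected by (simp add: toroidal_grid_simps)
qed

lemma inv_cycle_of_list4:
  assumes "distinct [w, x, y, z]"
  shows "inv (cycle_of_list [w, x, y, z]) w = z" "inv (cycle_of_list [w, x, y, z]) x = w"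
    "inv (cycle_of_list [w, x, y, z]) y = x" "inv (cycle_of_list [w, x, y, z]) z = y"
proof -
  let ?c = "cycle_of_list [w, x, y, z]"
  have inj: "inj ?c"
    using cycle_permutes[of "[w, x, y, z]"] permutes_inj by blast
  have "?c z = w" "?c w = x" "?c x = y" "?c y = z"
    using assms by (auto simp: transpose_def)
  then show "inv ?c w = z" "inv ?c x = w" "inv ?c y = x" "inv ?c z = y"
    using inv_f_eq[OF inj] by blast+
qed

lemma toroidal_grid_next_arc:
  assumes "(a, b) \<in> grid_verts n m"
  shows "next_arc (toroidal_grid n m) (Fwd (RightE (a, b))) = Fwd (DownE (a, (b + 1) mod int m))"
    and "next_arc (toroidal_grid n m) (Fwd (DownE (a, b)))
      = Bwd (RightE ((a + 1) mod int n, (b - 1) mod int m))"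
    and "next_arc (toroidal_grid n m) (Bwd (RightE (a, b))) = Bwd (DownE ((a - 1) mod int n, b))"
    and "next_arc (toroidal_grid n m) (Bwd (DownE (a, b))) = Fwd (RightE (a, b))"
  using assms
  by (auto simp: next_arc_def head_def toroidal_grid_simps grid_verts_def mod_pred_succ
      inv_cycle_of_list4 simp del: cycle_of_list.simps)

lemma toroidal_grid_face:
  assumes "(a, b) \<in> grid_verts n m"
  defines "f \<equiv> {Fwd (RightE (a, b)), Fwd (DownE (a, (b + 1) mod int m)),
      Bwd (RightE ((a + 1) mod int n, b)), Bwd (DownE (a, b))}"
  assumes "x \<in> f"
  shows "face_of (toroidal_grid n m) x = f"
proof -
  let ?\<phi> = "next_arc (toroidal_grid n m)"
  have b: "0 \<le> a" "a < int n" "0 \<le> b" "b < int m"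
    using assms(1) by (auto simp: grid_verts_def)
  have in_grid: "(a, (b + 1) mod int m) \<in> grid_verts n m" "((a + 1) mod int n, b) \<in> grid_verts n m"
    using b by (auto simp: grid_verts_def)
  have step: "?\<phi> (Fwd (RightE (a, b))) = Fwd (DownE (a, (b + 1) mod int m))"
    "?\<phi> (Fwd (DownE (a, (b + 1) mod int m))) = Bwd (RightE ((a + 1) mod int n, b))"
    "?\<phi> (Bwd (RightE ((a + 1) mod int n, b))) = Bwd (DownE (a, b))"
    "?\<phi> (Bwd (DownE (a, b))) = Fwd (RightE (a, b))"
    using toroidal_grid_next_arc[OF assms(1)] toroidal_grid_next_arc[OF in_grid(1)]
      toroidal_grid_next_arc[OF in_grid(2)] b by (simp_all add: mod_pred_succ)
  have sub: "orbit ?\<phi> x \<subseteq> f"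
  proof
    fix y assume "y \<in> orbit ?\<phi> x"
    then show "y \<in> f" using \<open>x \<in> f\<close>
      by induction (auto simp: f_def step)
  qed
  have closed: "?\<phi> y \<in> orbit ?\<phi> x" if "y \<in> orbit ?\<phi> x" for y
    using that by (rule orbit.step)
  have "?\<phi> x \<in> orbit ?\<phi> x" by (rule orbit.base)
  then have "f \<subseteq> orbit ?\<phi> x"
    using \<open>x \<in> f\<close> closed step unfolding f_def
    by (smt (verit) empty_iff insert_iff subsetI)
  with sub show ?thesis by (auto simp: face_of_def)
qed

lemma toroidal_grid_genus_1:
  assumes "n \<ge> 1" "m \<ge> 1"
  shows "euler_characteristic (toroidal_grid n m) = 0"
proof -
  let ?G = "toroidal_grid n m" and ?V = "grid_verts n m"
  let ?f = "\<lambda>w. face_of ?G (Fwd (RightE w))"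
  have "faces ?G = ?f ` ?V"
  proof
    show "?f ` ?V \<subseteq> faces ?G" by (auto simp: faces_def arcs_def toroidal_grid_simps)
    show "faces ?G \<subseteq> ?f ` ?V"
    proof
      fix g assume "g \<in> faces ?G"
      then obtain x where x: "x \<in> arcs ?G" "g = face_of ?G x" by (auto simp: faces_def)
      consider c d where "x = Fwd (RightE (c, d))" | c d where "x = Fwd (DownE (c, d))"
        | c d where "x = Bwd (RightE (c, d))" | c d where "x = Bwd (DownE (c, d))"
        by (metis arc.exhaust grid_edge.exhaust surj_pair)
      then have "\<exists>a b. (a, b) \<in> ?V \<and> x \<in> {Fwd (RightE (a, b)), Fwd (DownE (a, (b + 1) mod int m)),
          Bwd (RightE ((a + 1) mod int n, b)), Bwd (DownE (a, b))}"
      proof cases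
        case (2 c d)
        then show ?thesis using x(1)
          by (intro exI[of _ c] exI[of _ "(d - 1) mod int m"])
            (auto simp: arcs_def toroidal_grid_simps grid_verts_def mod_pred_succ)
      next
        case (3 c d)
        then show ?thesis using x(1)
          by (intro exI[of _ "(c - 1) mod int n"] exI[of _ d])
            (auto simp: arcs_def toroidal_grid_simps grid_verts_def mod_pred_succ)
      qed (use x(1) in \<open>auto simp: arcs_def toroidal_grid_simps\<close>)
      then obtain a b where ab: "(a, b) \<in> ?V"
        "x \<in> {Fwd (RightE (a, b)), Fwd (DownE (a, (b + 1) mod int m)),
          Bwd (RightE ((a + 1) mod int n, b)), Bwd (DownE (a, b))}" by blast
      have "g = ?f (a, b)"
        using toroidal_grid_face[OF ab] toroidal_grid_face[OF ab(1), of "Fwd (RightE (a, b))"] x(2)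
        by simp
      with ab(1) show "g \<in> ?f ` ?V" by blast
    qed
  qed
  moreover have "inj_on ?f ?V"
  proof (rule inj_onI)
    fix v w assume vw: "v \<in> ?V" "w \<in> ?V" "?f v = ?f w"
    obtain a b c d where eq: "v = (a, b)" "w = (c, d)" by (metis surj_pair)
    show "v = w"
      using vw toroidal_grid_face[of a b n m "Fwd (RightE (a, b))"]
        toroidal_grid_face[of c d n m "Fwd (RightE (c, d))"] unfolding eq by auto
  qed
  ultimately have "card (faces ?G) = card ?V" by (simp add: card_image)
  moreover have "card (edges ?G) = card ?V + card ?V"
    unfolding toroidal_grid_simps
    by (subst card_Un_disjoint) (auto simp: card_image inj_on_def grid_verts_def)
  ultimately show ?thesis by (simp add: euler_characteristic_def toroidal_grid_simps)
qed

end

theory Submission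
  imports Defs
begin

text \<open>
  On a toroidal grid all vertices and faces have degree 4, and \<open>U\<close> preserves the space of functions
  \<open>p (tail) + q (face)\<close>: in terms of the averages \<open>B p\<close> over the vertices of a face and \<open>A q\<close> over the
  faces at a vertex it maps \<open>(p, q)\<close> to \<open>(- r, 2 B r - q)\<close> with \<open>r = p + 2 A q\<close>.  With at most two rows,
  a vertex function splits into its row average \<open>e\<close> and a part that \<open>U\<close> negates.  The powers of \<open>U\<close>
  send \<open>(e, 0)\<close> to \<open>(s\<^sup>k e - T\<^sub>k, T\<^sub>k)\<close>, where \<open>s\<close> is the shift along the rows and
  \<open>T\<^sub>k = \<Sum>\<^sub>-\<^sub>k\<^sub><\<^sub>j\<^sub>\<le>\<^sub>k s\<^sup>j e\<close>.  If \<open>m\<close> divides \<open>2 k\<close>, the function \<open>T\<^sub>k\<close> is constant and cancels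
  between vertices and faces, which leaves \<open>(-1)\<^sup>k (p - e) + s\<^sup>k e\<close>.
\<close>

section \<open>The reflections in vertex-constant and face-constant functions\<close>

context orientable_map
begin

lemma finite_arcs: "finite (arcs G)"
  using finite_edges by (simp add: arcs_def)

lemma tail_in_verts: "a \<in> arcs G \<Longrightarrow> tail G a \<in> verts G"
  using src_in tgt_in by (auto simp: arcs_def)

lemma finite_faces: "finite (faces G)"
  using finite_arcs by (simp add: faces_def)

lemma Nhat_eq:
  assumes "a \<in> arcs G"
  shows "Nhat G a w =
    (if w = tail G a then complex_of_real (1 / sqrt (degree G (tail G a))) else 0)"
proof -
  have "Nhat G a w = (\<Sum>v\<in>verts G. if v = tail G a then diag_inv_sqrt (D_mat G) v w else 0)"
    unfolding Nhat_def mmul_def by (rule sum.cong) (auto simp: N_mat_def)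
  also have "\<dots> = diag_inv_sqrt (D_mat G) (tail G a) w"
    using finite_verts tail_in_verts[OF assms] by simp
  finally show ?thesis
    by (auto simp: diag_inv_sqrt_def D_mat_eq[OF finite_arcs])
qed

lemma Mhat_eq:
  assumes "a \<in> arcs G"
  shows "Mhat G a f =
    (if f = face_of G a
     then complex_of_real (1 / sqrt (card {b \<in> arcs G. face_of G b = face_of G a})) else 0)"
proof -
  have "Mhat G a f = (\<Sum>g\<in>faces G. if g = face_of G a then diag_inv_sqrt (Delta_mat G) g f else 0)"
    unfolding Mhat_def mmul_def by (rule sum.cong) (auto simp: M_mat_def)
  also have "\<dots> = diag_inv_sqrt (Delta_mat G) (face_of G a) f"
    using finite_faces assms by (simp add: faces_def)
  finally show ?thesis
    by (auto simp: diag_inv_sqrt_def Delta_mat_eq[OF finite_arcs])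
qed

text \<open>The two factors \<open>1 / sqrt d\<close> multiply to \<open>1 / d\<close>, so
  \<open>Q_mat G\<close> averages over the arcs with a common tail. \<open>P_mat_eq\<close> is the
  dual for faces.\<close>

lemma Q_mat_eq:
  assumes "a \<in> arcs G" "b \<in> arcs G"
  shows "Q_mat G a b = (if tail G b = tail G a then 1 / of_nat (degree G (tail G a)) else 0)"
proof -
  have "Q_mat G a b = (\<Sum>w\<in>verts G. if w = tail G a then Nhat G a w * Nhat G b w else 0)"
    unfolding Q_mat_def mmul_def mtranspose_def
    by (rule sum.cong) (auto simp: Nhat_eq[OF assms(1)])
  also have "\<dots> = Nhat G a (tail G a) * Nhat G b (tail G a)"
    using finite_verts tail_in_verts[OF assms(1)] by simp
  also have "\<dots> = (if tail G b = tail G a then 1 / of_nat (degree G (tail G a)) else 0)"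
    by (auto simp: Nhat_eq[OF assms(1)] Nhat_eq[OF assms(2)] simp flip: of_real_mult)
  finally show ?thesis .
qed

lemma P_mat_eq:
  assumes "a \<in> arcs G" "b \<in> arcs G"
  shows "P_mat G a b = (if face_of G b = face_of G a
    then 1 / of_nat (card {c \<in> arcs G. face_of G c = face_of G a}) else 0)"
proof -
  have "P_mat G a b = (\<Sum>f\<in>faces G. if f = face_of G a then Mhat G a f * Mhat G b f else 0)"
    unfolding P_mat_def mmul_def mtranspose_def
    by (rule sum.cong) (auto simp: Mhat_eq[OF assms(1)])
  also have "\<dots> = Mhat G a (face_of G a) * Mhat G b (face_of G a)"
    using finite_faces assms(1) by (simp add: faces_def)
  also have "\<dots> = (if face_of G b = face_of G a
      then 1 / of_nat (card {c \<in> arcs G. face_of G c = face_of G a}) else 0)"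
    by (auto simp: Mhat_eq[OF assms(1)] Mhat_eq[OF assms(2)] simp flip: of_real_mult)
  finally show ?thesis .
qed

end

section \<open>Matrices acting on vectors over the arcs\<close>

lemma mvec_cong: "(\<And>j. j \<in> J \<Longrightarrow> x j = y j) \<Longrightarrow> mvec J A x = mvec J A y"
  by (auto simp: mvec_def)

lemma mvec_mmul: "mvec J (mmul K A B) x = mvec K A (mvec J B x)"
proof
  fix i
  have "mvec J (mmul K A B) x i = (\<Sum>j\<in>J. \<Sum>k\<in>K. A i k * (B k j * x j))"
    by (simp add: mvec_def mmul_def sum_distrib_right mult.assoc)
  also have "\<dots> = mvec K A (mvec J B x) i"
    unfolding mvec_def sum_distrib_left by (rule sum.swap)
  finally show "mvec J (mmul K A B) x i = mvec K A (mvec J B x) i" .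
qed

lemma mvec_reflection:
  assumes "finite I" "i \<in> I"
  shows "mvec I (reflection A) x i = 2 * mvec I A x i - x i"
proof -
  have "(\<Sum>j\<in>I. mone i j * x j) = (\<Sum>j\<in>I. if j = i then x i else 0)"
    by (rule sum.cong) (auto simp: mone_def)
  then show ?thesis
    using assms by (simp add: mvec_def reflection_def left_diff_distrib sum_subtractf
        sum_distrib_left mult.assoc)
qed

lemma (in orientable_map) mvec_reflection_Q:
  assumes "a \<in> arcs G"
  shows "mvec (arcs G) (reflection (Q_mat G)) x a =
    2 * (\<Sum>b | b \<in> arcs G \<and> tail G b = tail G a. x b) / of_nat (degree G (tail G a)) - x a"
proof -
  have "mvec (arcs G) (Q_mat G) x a
      = (\<Sum>b\<in>arcs G. if tail G b = tail G a then x b / of_nat (degree G (tail G a)) else 0)"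
    unfolding mvec_def by (rule sum.cong) (auto simp: Q_mat_eq assms)
  also have "\<dots> = (\<Sum>b | b \<in> arcs G \<and> tail G b = tail G a. x b) / of_nat (degree G (tail G a))"
    unfolding sum_divide_distrib by (simp add: sum.inter_filter finite_arcs)
  finally show ?thesis
    by (simp add: mvec_reflection finite_arcs assms)
qed

lemma (in orientable_map) mvec_reflection_P:
  assumes "a \<in> arcs G"
  shows "mvec (arcs G) (reflection (P_mat G)) x a =
    2 * (\<Sum>b | b \<in> arcs G \<and> face_of G b = face_of G a. x b)
      / of_nat (card {b \<in> arcs G. face_of G b = face_of G a}) - x a"
proof -
  let ?c = "of_nat (card {b \<in> arcs G. face_of G b = face_of G a}) :: complex"
  have "mvec (arcs G) (P_mat G) x a
      = (\<Sum>b\<in>arcs G. if face_of G b = face_of G a then x b / ?c else 0)"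
    unfolding mvec_def by (rule sum.cong) (auto simp: P_mat_eq assms)
  also have "\<dots> = (\<Sum>b | b \<in> arcs G \<and> face_of G b = face_of G a. x b) / ?c"
    unfolding sum_divide_distrib by (simp add: sum.inter_filter finite_arcs)
  finally show ?thesis
    by (simp add: mvec_reflection finite_arcs assms)
qed


section \<open>One step of the walk on a toroidal grid\<close>

fun grid_face_index :: "nat \<Rightarrow> nat \<Rightarrow> grid_edge arc \<Rightarrow> int \<times> int" where
  "grid_face_index n m (Fwd (RightE (a, b))) = (a, b)"
| "grid_face_index n m (Fwd (DownE (a, b))) = (a, (b - 1) mod int m)"
| "grid_face_index n m (Bwd (RightE (a, b))) = ((a - 1) mod int n, b)"
| "grid_face_index n m (Bwd (DownE (a, b))) = (a, b)"

text \<open>A face is a unit square, named by its only arc of the form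
  \<open>Fwd (RightE w)\<close>; faces and vertices thus share one index set. The four arcs stay
  distinct even when \<open>n\<close> or \<open>m\<close> is 1.\<close>

definition grid_face :: "nat \<Rightarrow> nat \<Rightarrow> int \<times> int \<Rightarrow> grid_edge arc set" where
  "grid_face n m = (\<lambda>(a, b). {Fwd (RightE (a, b)), Fwd (DownE (a, (b + 1) mod int m)),
      Bwd (RightE ((a + 1) mod int n, b)), Bwd (DownE (a, b))})"

lemma grid_arc_cases:
  assumes "x \<in> arcs (toroidal_grid n m)"
  obtains a b where "x = Fwd (RightE (a, b))" "0 \<le> a" "a < int n" "0 \<le> b" "b < int m"
  | a b where "x = Fwd (DownE (a, b))" "0 \<le> a" "a < int n" "0 \<le> b" "b < int m"
  | a b where "x = Bwd (RightE (a, b))" "0 \<le> a" "a < int n" "0 \<le> b" "b < int m"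
  | a b where "x = Bwd (DownE (a, b))" "0 \<le> a" "a < int n" "0 \<le> b" "b < int m"
  using assms by (auto simp: arcs_def toroidal_grid_simps grid_verts_def)

lemma grid_face_index_in_verts:
  assumes "x \<in> arcs (toroidal_grid n m)"
  shows "grid_face_index n m x \<in> grid_verts n m"
  using assms by (cases rule: grid_arc_cases) (auto simp: grid_verts_def)

lemma mem_grid_face_iff:
  assumes "w \<in> grid_verts n m"
  shows "x \<in> grid_face n m w \<longleftrightarrow> x \<in> arcs (toroidal_grid n m) \<and> grid_face_index n m x = w"
proof -
  obtain a b where w: "w = (a, b)" by (cases w)
  have b: "0 \<le> a" "a < int n" "0 \<le> b" "b < int m"
    using assms by (auto simp: w grid_verts_def)
  consider c d where "x = Fwd (RightE (c, d))" | c d where "x = Fwd (DownE (c, d))"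
    | c d where "x = Bwd (RightE (c, d))" | c d where "x = Bwd (DownE (c, d))"
    by (metis arc.exhaust grid_edge.exhaust surj_pair)
  then show ?thesis
    using b by cases
      (auto simp: w grid_face_def arcs_def toroidal_grid_simps grid_verts_def mod_pred_succ)
qed

lemma face_of_toroidal_grid:
  assumes "x \<in> arcs (toroidal_grid n m)"
  shows "face_of (toroidal_grid n m) x = grid_face n m (grid_face_index n m x)"
proof -
  obtain a b where ab: "grid_face_index n m x = (a, b)" by fastforce
  have "(a, b) \<in> grid_verts n m"
    using grid_face_index_in_verts[OF assms] ab by simp
  moreover from this have "x \<in> grid_face n m (a, b)"
    using assms ab by (simp add: mem_grid_face_iff)
  ultimately show ?thesis
    using toroidal_grid_face[of a b n m x] by (simp add: ab grid_face_def)
qed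

text \<open>Every arc \<open>y\<close> lies in the \<open>grid_face\<close> of its own index, so an
  arc whose face equals that of \<open>x\<close> lies in the \<open>grid_face\<close> of
  \<open>x\<close>.\<close>

lemma arcs_in_face_toroidal_grid:
  assumes "x \<in> arcs (toroidal_grid n m)"
  shows "{y \<in> arcs (toroidal_grid n m). face_of (toroidal_grid n m) y = face_of (toroidal_grid n m) x}
    = grid_face n m (grid_face_index n m x)" (is "?L = ?R")
proof -
  have "y \<in> ?L \<longleftrightarrow> y \<in> ?R" for y
    using assms face_of_toroidal_grid[of _ n m] mem_grid_face_iff[of _ n m]
      grid_face_index_in_verts[of _ n m] by (smt (verit) mem_Collect_eq)
  then show ?thesis by blast
qed

lemma arcs_at_vertex_toroidal_grid:
  assumes "(a, b) \<in> grid_verts n m"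
  shows "{x \<in> arcs (toroidal_grid n m). tail (toroidal_grid n m) x = (a, b)}
    = {Fwd (RightE (a, b)), Fwd (DownE (a, b)),
       Bwd (RightE (a, (b - 1) mod int m)), Bwd (DownE ((a - 1) mod int n, b))}"
proof -
  have "n \<ge> 1" "m \<ge> 1" using assms by (auto simp: grid_verts_def)
  then interpret orientable_map "toroidal_grid n m"
    by (rule toroidal_grid_orientable_map)
  show ?thesis
    using set_rotation[of "(a, b)"] assms by (simp add: toroidal_grid_simps)
qed

text \<open>Arcs are counted, not neighbours: a loop contributes two, so one row or one column is no
  exception.\<close>

lemma degree_toroidal_grid:
  assumes "w \<in> grid_verts n m"
  shows "degree (toroidal_grid n m) w = 4"
  using assms by (cases w) (simp add: degree_def arcs_at_vertex_toroidal_grid)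

text \<open>With functions on all pairs of integers, shifts by 1 need no reduction. The congruence
  form identifies reduced with unreduced coordinates in one application.\<close>

definition torus_periodic :: "nat \<Rightarrow> nat \<Rightarrow> (int \<Rightarrow> int \<Rightarrow> 'a) \<Rightarrow> bool" where
  "torus_periodic n m p \<longleftrightarrow> (\<forall>a b a' b'.
     a mod int n = a' mod int n \<longrightarrow> b mod int m = b' mod int m \<longrightarrow> p a b = p a' b')"

lemma torus_periodicD:
  assumes "torus_periodic n m p"
  shows "a mod int n = a' mod int n \<Longrightarrow> b mod int m = b' mod int m \<Longrightarrow> p a b = p a' b'"
  using assms unfolding torus_periodic_def by blast

text \<open>
  For torus-periodic \<open>p\<close> and \<open>q\<close> this is the function \<open>x \<mapsto> p (tail of x) + q (face of x)\<close>.
\<close>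

fun lift :: "(int \<Rightarrow> int \<Rightarrow> complex) \<Rightarrow> (int \<Rightarrow> int \<Rightarrow> complex) \<Rightarrow> grid_edge arc \<Rightarrow> complex" where
  "lift p q (Fwd (RightE (a, b))) = p a b + q a b"
| "lift p q (Fwd (DownE (a, b))) = p a b + q a (b - 1)"
| "lift p q (Bwd (RightE (a, b))) = p a (b + 1) + q (a - 1) b"
| "lift p q (Bwd (DownE (a, b))) = p (a + 1) b + q a b"

lemma lift_eq_tail_face:
  assumes "torus_periodic n m p" "torus_periodic n m q" "x \<in> arcs (toroidal_grid n m)"
  shows "lift p q x = case_prod p (tail (toroidal_grid n m) x) + case_prod q (grid_face_index n m x)"
  using assms(3)
  by (cases rule: grid_arc_cases)
    (auto simp: toroidal_grid_simps 
      intro!: arg_cong2[where f = "(+)"] torus_periodicD[OF assms(1)] torus_periodicD[OF assms(2)])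

lemma torus_periodic_translate:
  assumes "torus_periodic n m p" "a mod int n = a' mod int n" "b mod int m = b' mod int m"
  shows "p (a + i) (b + j) = p (a' + i) (b' + j)"
  by (intro torus_periodicD[OF assms(1)] mod_add_cong assms refl)

definition face_avg :: "(int \<Rightarrow> int \<Rightarrow> complex) \<Rightarrow> int \<Rightarrow> int \<Rightarrow> complex" where
  "face_avg p a b = (p a b + p a (b + 1) + p (a + 1) (b + 1) + p (a + 1) b) / 4"

text \<open>These are the four squares around a vertex. On a small torus some coincide and are
  counted with multiplicity, as in the sum over arcs.\<close>

definition vertex_avg :: "(int \<Rightarrow> int \<Rightarrow> complex) \<Rightarrow> int \<Rightarrow> int \<Rightarrow> complex" where
  "vertex_avg q a b = (q a b + q a (b - 1) + q (a - 1) (b - 1) + q (a - 1) b) / 4"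

lemma torus_periodic_face_avg:
  assumes "torus_periodic n m p"
  shows "torus_periodic n m (face_avg p)"
proof -
  have "face_avg p a b = face_avg p a' b'"
    if "a mod int n = a' mod int n" "b mod int m = b' mod int m" for a b a' b'
    using torus_periodic_translate[OF assms that, of 0 0]
    torus_periodic_translate[OF assms that, of 0 1]
    torus_periodic_translate[OF assms that, of 1 1]
    torus_periodic_translate[OF assms that, of 1 0]
    by (simp add: face_avg_def)
  then show ?thesis unfolding torus_periodic_def by blast
qed

lemma torus_periodic_vertex_avg:
  assumes "torus_periodic n m p"
  shows "torus_periodic n m (vertex_avg p)"
proof -
  have "vertex_avg p a b = vertex_avg p a' b'"
    if "a mod int n = a' mod int n" "b mod int m = b' mod int m" for a b a' b'
    using torus_periodic_translate[OF assms that, of 0 0]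
    torus_periodic_translate[OF assms that, of 0 "-1"]
    torus_periodic_translate[OF assms that, of "-1" "-1"]
    torus_periodic_translate[OF assms that, of "-1" 0]
    by (simp add: vertex_avg_def)
  then show ?thesis unfolding torus_periodic_def by blast
qed

lemma torus_periodic_add:
  fixes p q :: "int \<Rightarrow> int \<Rightarrow> complex"
  assumes "torus_periodic n m p" "torus_periodic n m q"
  shows "torus_periodic n m (\<lambda>a b. c * p a b + d * q a b)"
  unfolding torus_periodic_def
  by (intro allI impI arg_cong2[where f = "\<lambda>x y. c * x + d * y"]
      torus_periodicD[OF assms(1)] torus_periodicD[OF assms(2)])

text \<open>Over the arcs at a vertex, \<open>p\<close> is constant and \<open>q\<close> has mean
  \<open>vertex_avg q\<close>; doubling this mean and subtracting the original gives the new pair.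
  The coefficients \<open>1 *\<close> and \<open>0 *\<close> fit both components to
  \<open>torus_periodic_add\<close>.\<close>

lemma lift_reflection_Q:
  assumes p: "torus_periodic n m p" and q: "torus_periodic n m q"
    and x: "x \<in> arcs (toroidal_grid n m)"
  shows "mvec (arcs (toroidal_grid n m)) (reflection (Q_mat (toroidal_grid n m))) (lift p q) x
    = lift (\<lambda>a b. 1 * p a b + 2 * vertex_avg q a b) (\<lambda>a b. 0 * q a b + (-1) * q a b) x"
    (is "_ = lift ?p ?q x")
proof -
  let ?G = "toroidal_grid n m"
  obtain a b where ab: "tail ?G x = (a, b)" by fastforce
  have "n \<ge> 1" "m \<ge> 1" using x by (auto elim!: grid_arc_cases)
  then interpret orientable_map ?G
    by (rule toroidal_grid_orientable_map)
  have V: "(a, b) \<in> grid_verts n m"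
    using tail_in_verts[OF x] by (simp add: ab toroidal_grid_simps)
  have "p a ((b - 1) mod int m + 1) = p a b" "p ((a - 1) mod int n + 1) b = p a b"
    "q (a - 1) ((b - 1) mod int m) = q (a - 1) (b - 1)" "q ((a - 1) mod int n) b = q (a - 1) b"
    by (auto intro!: torus_periodicD[OF p] torus_periodicD[OF q] simp: mod_simps)
  then have "(\<Sum>y | y \<in> arcs ?G \<and> tail ?G y = tail ?G x. lift p q y)
      = 4 * p a b + 4 * vertex_avg q a b"
    by (simp add: ab arcs_at_vertex_toroidal_grid[OF V] vertex_avg_def field_simps)
  then have "mvec (arcs ?G) (reflection (Q_mat ?G)) (lift p q) x
      = 2 * p a b + 2 * vertex_avg q a b - lift p q x"
    by (simp add: mvec_reflection_Q[OF x] ab degree_toroidal_grid[OF V])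
  also have "\<dots> = lift ?p ?q x"
    using lift_eq_tail_face[OF p q x]
      lift_eq_tail_face[OF torus_periodic_add[OF p torus_periodic_vertex_avg[OF q], of 1 2]
        torus_periodic_add[OF q q, of 0 "-1"] x]
    by (simp add: ab split: prod.splits)
  finally show ?thesis .
qed

text \<open>Dual to \<open>lift_reflection_Q\<close>: over the arcs of a face, \<open>q\<close> is
  constant and the tails run through the four corners.\<close>

lemma lift_reflection_P:
  assumes p: "torus_periodic n m p" and q: "torus_periodic n m q"
    and x: "x \<in> arcs (toroidal_grid n m)"
  shows "mvec (arcs (toroidal_grid n m)) (reflection (P_mat (toroidal_grid n m))) (lift p q) x
    = lift (\<lambda>a b. 0 * p a b + (-1) * p a b) (\<lambda>a b. 1 * q a b + 2 * face_avg p a b) x"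
    (is "_ = lift ?p ?q x")
proof -
  let ?G = "toroidal_grid n m"
  obtain a b where ab: "grid_face_index n m x = (a, b)" by fastforce
  have "n \<ge> 1" "m \<ge> 1" using x by (auto elim!: grid_arc_cases)
  then interpret orientable_map ?G
    by (rule toroidal_grid_orientable_map)
  have "p a ((b + 1) mod int m) = p a (b + 1)" "q a ((b + 1) mod int m - 1) = q a b"
    "p ((a + 1) mod int n) (b + 1) = p (a + 1) (b + 1)" "q ((a + 1) mod int n - 1) b = q a b"
    by (auto intro!: torus_periodicD[OF p] torus_periodicD[OF q] simp: mod_simps)
  then have "(\<Sum>y\<in>grid_face n m (a, b). lift p q y) = 4 * q a b + 4 * face_avg p a b"
    by (simp add: grid_face_def face_avg_def field_simps)
  moreover have "card (grid_face n m (a, b)) = 4"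
    by (simp add: grid_face_def)
  ultimately have "mvec (arcs ?G) (reflection (P_mat ?G)) (lift p q) x
      = 2 * q a b + 2 * face_avg p a b - lift p q x"
    by (simp add: mvec_reflection_P[OF x] arcs_in_face_toroidal_grid[OF x] ab)
  also have "\<dots> = lift ?p ?q x"
    using lift_eq_tail_face[OF p q x]
      lift_eq_tail_face[OF torus_periodic_add[OF p p, of 0 "-1"]
        torus_periodic_add[OF q torus_periodic_face_avg[OF p], of 1 2] x]
    by (simp add: ab split: prod.splits)
  finally show ?thesis .
qed

lemma lift_U:
  assumes p: "torus_periodic n m p" and q: "torus_periodic n m q"
    and x: "x \<in> arcs (toroidal_grid n m)"
  defines "r \<equiv> \<lambda>a b. p a b + 2 * vertex_avg q a b"
  shows "mvec (arcs (toroidal_grid n m)) (U_mat (toroidal_grid n m)) (lift p q) x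
    = lift (\<lambda>a b. - r a b) (\<lambda>a b. 2 * face_avg r a b - q a b) x"
proof -
  let ?A = "arcs (toroidal_grid n m)"
  let ?q = "\<lambda>a b. 0 * q a b + (-1) * q a b"
  have r: "torus_periodic n m r"
    using torus_periodic_add[OF p torus_periodic_vertex_avg[OF q], of 1 2] by (simp add: r_def)
  \<comment> \<open>The vertex reflection acts first and leads to the intermediate pair
    \<open>(r, - q)\<close>.\<close>
  have "mvec ?A (U_mat (toroidal_grid n m)) (lift p q) x
      = mvec ?A (reflection (P_mat (toroidal_grid n m))) (lift r ?q) x"
    unfolding U_mat_def mvec_mmul
    using lift_reflection_Q[OF p q] by (intro fun_cong[OF mvec_cong]) (simp add: r_def)
  also have "\<dots> = lift (\<lambda>a b. - r a b) (\<lambda>a b. 2 * face_avg r a b - q a b) x"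
    using lift_reflection_P[OF r torus_periodic_add[OF q q, of 0 "-1"] x] by simp
  finally show ?thesis .
qed


section \<open>Powers of the transition matrix for one or two rows\<close>

text \<open>For one row both summands agree, for two rows they are the two rows, so this is the
  average over all rows in either case.\<close>

definition row_avg :: "(int \<Rightarrow> int \<Rightarrow> complex) \<Rightarrow> int \<Rightarrow> int \<Rightarrow> complex" where
  "row_avg p a b = (p a b + p (a + 1) b) / 2"

text \<open>The sum of \<open>2 k\<close> consecutive values, centred at \<open>b + 1/2\<close> as
  befits a face. Passing to \<open>k + 1\<close> adds one value at each end.\<close>

definition window :: "nat \<Rightarrow> (int \<Rightarrow> complex) \<Rightarrow> int \<Rightarrow> complex" where
  "window k f b = (\<Sum>j<k. f (b + int j + 1) + f (b - int j))"

text \<open>Moving the interval one place to the left gains its new left end and loses its old right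
  end.\<close>

lemma window_pred: "window k f (b - 1) = window k f b + f (b - int k) - f (b + int k)"
  by (induction k) (auto simp: window_def algebra_simps)

lemma torus_periodic_row_avg:
  assumes "torus_periodic n m p"
  shows "torus_periodic n m (row_avg p)"
proof -
  have "row_avg p a b = row_avg p a' b'"
    if "a mod int n = a' mod int n" "b mod int m = b' mod int m" for a b a' b'
    using torus_periodic_translate[OF assms that, of 0 0]
    torus_periodic_translate[OF assms that, of 1 0]
    by (simp add: row_avg_def)
  then show ?thesis unfolding torus_periodic_def by blast
qed

lemma torus_periodic_shift:
  assumes "torus_periodic n m p"
  shows "torus_periodic n m (\<lambda>a b. p a (b + c))"
  unfolding torus_periodic_def
  by (intro allI impI torus_periodicD[OF assms] mod_add_cong refl)

lemma torus_periodic_window: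
  assumes "torus_periodic n m p"
  shows "torus_periodic n m (\<lambda>a. window k (p a))"
  unfolding torus_periodic_def window_def
  by (intro allI impI sum.cong refl arg_cong2[where f = "(+)"] torus_periodicD[OF assms])
    (auto intro: mod_add_cong mod_diff_cong)

text \<open>Two steps down return to the same row, so one step only swaps the two summands.\<close>

lemma row_avg_succ:
  assumes "torus_periodic n m p" "n dvd 2"
  shows "row_avg p (a + 1) b = row_avg p a b"
proof -
  have "(a + 1 + 1) mod int n = a mod int n"
    using assms(2) by (auto simp: mod_eq_dvd_iff dest: int_dvd_int_iff[THEN iffD2])
  then have "p (a + 1 + 1) b = p a b"
    by (intro torus_periodicD[OF assms(1)]) auto
  then show ?thesis by (simp add: row_avg_def)
qed

text \<open>
  The closed form comes from the fact that, on pairs \<open>(p, q)\<close> that do not depend on the row, a step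
  of the walk has characteristic polynomial \<open>(X - s) (X - s\<^sup>-\<^sup>1)\<close>.
\<close>

lemma lift_U_pow:
  assumes p: "torus_periodic n m p" and n: "n dvd 2" and x: "x \<in> arcs (toroidal_grid n m)"
  defines "e \<equiv> row_avg p"
  shows "mvec (arcs (toroidal_grid n m)) (mpow (arcs (toroidal_grid n m)) (U_mat (toroidal_grid n m)) k)
      (lift p (\<lambda>a b. 0)) x
    = lift (\<lambda>a b. (-1) ^ k * (p a b - e a b) + e a (b + int k) - window k (e a) b)
        (\<lambda>a. window k (e a)) x"
  using x
proof (induction k arbitrary: x)
  case 0
  have "finite (arcs (toroidal_grid n m))"
    by (simp add: arcs_def toroidal_grid_simps grid_verts_def)
  moreover have "mvec I mone y i = y i" if "finite I" "i \<in> I" for I i and y :: "grid_edge arc \<Rightarrow> complex"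
    using that by (simp add: mvec_def mone_def if_distrib[of "\<lambda>t. t * _"] cong: if_cong)
  ultimately have "mvec (arcs (toroidal_grid n m)) mone (lift p (\<lambda>a b. 0)) x = lift p (\<lambda>a b. 0) x"
    using 0 by blast
  then show ?case by (simp add: window_def)
next
  case (Suc k)
  let ?G = "toroidal_grid n m"
  define P where "P = (\<lambda>k a b. (-1) ^ k * (p a b - e a b) + e a (b + int k) - window k (e a) b)"
  define T where "T = (\<lambda>k a. window k (e a))"
  have e: "torus_periodic n m e"
    unfolding e_def by (rule torus_periodic_row_avg[OF p])
  have T: "torus_periodic n m (T k)"
    unfolding T_def by (rule torus_periodic_window[OF e])
  have P: "torus_periodic n m (P k)"
    using torus_periodic_add[OF torus_periodic_add[OF p e, of "(-1)^k" "-((-1)^k)"]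
        torus_periodic_add[OF torus_periodic_shift[OF e, of "int k"] T, of 1 "-1"], of 1 1]
    by (simp add: P_def T_def algebra_simps)
  have e1: "e (a + 1) = e a" for a
    unfolding e_def using row_avg_succ[OF p n] by blast
  have e0: "e (a - 1) = e a" for a
    using e1[of "a - 1"] by simp
  have T1: "T k (a + 1) = T k a" and T0: "T k (a - 1) = T k a" for a
    by (simp_all add: T_def e1 e0)
  have Tsuc: "T (Suc k) a b = T k a b + e a (b + int k + 1) + e a (b - int k)" for a b
    by (simp add: T_def window_def)
  have Tpred: "T k a (b - 1) = T k a b + e a (b - int k) - e a (b + int k)" for a b
    by (simp add: T_def window_pred)
  define r where "r = (\<lambda>a b. P k a b + 2 * vertex_avg (T k) a b)"
  \<comment> \<open>As \<open>T k\<close> does not depend on the row,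
    \<open>2 * vertex_avg (T k)\<close> is the sum of \<open>T k\<close> at \<open>b\<close> and
    \<open>b - 1\<close>. By \<open>Tpred\<close> this absorbs both \<open>- T k\<close> and
    \<open>e a (b + int k)\<close> from \<open>P k\<close>.\<close>
  have r: "r a b = (-1) ^ k * (p a b - e a b) + (T k a b + e a (b - int k))" for a b
    by (simp add: r_def vertex_avg_def P_def T0 Tpred field_simps flip: T_def)
      (simp add: T_def algebra_simps)
  \<comment> \<open>The terms \<open>T k\<close> and \<open>e a (b - int k)\<close> of
    \<open>r\<close> are \<open>T (Suc k)\<close> without its new right end, which is the shifted
    term of \<open>P (Suc k)\<close>.\<close>
  have P_step: "- r a b = P (Suc k) a b" for a b
    unfolding r P_def using Tsuc[of a b] by (simp add: T_def algebra_simps)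
  have T_step: "2 * face_avg r a b - T k a b = T (Suc k) a b" for a b
  proof -
    \<comment> \<open>The part \<open>p - e\<close> changes sign between the two rows that a face
      touches, so it vanishes from every face average.\<close>
    have z: "(p a b' - e a b') + (p (a + 1) b' - e a b') = 0" for b'
      by (simp add: e_def row_avg_def)
    have "2 * face_avg r a b = (-1) ^ k * (((p a b - e a b) + (p (a + 1) b - e a b))
          + ((p a (b+1) - e a (b+1)) + (p (a + 1) (b+1) - e a (b+1)))) / 2
        + (T k a b + e a (b - int k)) + (T k a (b + 1) + e a (b + 1 - int k))"
      unfolding face_avg_def r e1 T1 by (simp add: field_simps)
    also have "\<dots> = (T k a b + e a (b - int k)) + (T k a (b + 1) + e a (b + 1 - int k))"
      unfolding z by simp
    \<comment> \<open>By \<open>Tpred\<close> at \<open>b + 1\<close>, the second bracket is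
      \<open>T k a b\<close> plus the new right end; the first one supplies the new left
      end.\<close>
    finally show ?thesis
      using Tpred[of a "b + 1"] Tsuc[of a b] by (simp add: algebra_simps)
  qed
  have "mvec (arcs ?G) (mpow (arcs ?G) (U_mat ?G) (Suc k)) (lift p (\<lambda>a b. 0)) x
      = mvec (arcs ?G) (U_mat ?G) (lift (P k) (T k)) x"
    using Suc.IH unfolding mpow.simps mvec_mmul P_def T_def
    by (intro fun_cong[OF mvec_cong])
  also have "\<dots> = lift (P (Suc k)) (T (Suc k)) x"
    using lift_U[OF P T Suc.prems] by (simp only: P_step[unfolded r_def] T_step[unfolded r_def])
  finally show ?case unfolding P_def T_def .
qed

text \<open>A window of \<open>2 k\<close> values now winds round the row a whole number of times,
  so it is constant. A constant subtracted at vertices and added at faces has lift 0.\<close>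

lemma lift_U_pow_periodic:
  assumes p: "torus_periodic n m p" and n: "n dvd 2" and x: "x \<in> arcs (toroidal_grid n m)"
    and k: "m dvd 2 * k"
  shows "mvec (arcs (toroidal_grid n m)) (mpow (arcs (toroidal_grid n m)) (U_mat (toroidal_grid n m)) k)
      (lift p (\<lambda>a b. 0)) x
    = lift (\<lambda>a b. (-1) ^ k * (p a b - row_avg p a b) + row_avg p a (b + int k)) (\<lambda>a b. 0) x"
proof -
  let ?T = "\<lambda>a. window k (row_avg p a)"
  have "int m dvd int (2 * k)" using k by (simp only: int_dvd_int_iff)
  then have "(b + int k) mod int m = (b - int k) mod int m" for b
    by (simp add: mod_eq_dvd_iff)
  then have "row_avg p a (b - int k) = row_avg p a (b + int k)" for a b
    by (intro torus_periodicD[OF torus_periodic_row_avg[OF p]]) auto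
  then have T: "?T a (b - 1) = ?T a b" for a b
    by (simp add: window_pred)
  have T1: "?T a (b + 1) = ?T a b" for a b
    using T[of a "b + 1"] by simp
  have R: "row_avg p (a + 1) = row_avg p a" for a
    using row_avg_succ[OF p n] by blast
  have R0: "row_avg p (a - 1) = row_avg p a" for a
    using R[of "a - 1"] by simp
  show ?thesis
    unfolding lift_U_pow[OF p n x]
    using x by (cases rule: grid_arc_cases) (simp_all add: T T1 R R0)
qed


section \<open>Periodicity and perfect state transfer\<close>

text \<open>The value \<open>1 / 2\<close> is \<open>1 / sqrt 4\<close>, for degree 4: the lift is
  the column of \<open>Nhat\<close> at \<open>w\<close>. The index \<open>w\<close> is meant in
  reduced form.\<close>

definition torus_delta :: "nat \<Rightarrow> nat \<Rightarrow> int \<times> int \<Rightarrow> int \<Rightarrow> int \<Rightarrow> complex" where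
  "torus_delta n m w a b = (if (a mod int n, b mod int m) = w then 1 / 2 else 0)"

lemma torus_periodic_delta: "torus_periodic n m (torus_delta n m w)"
  by (simp add: torus_periodic_def torus_delta_def)

lemma Nhat_toroidal_grid:
  assumes "x \<in> arcs (toroidal_grid n m)"
  shows "Nhat (toroidal_grid n m) x w = lift (torus_delta n m w) (\<lambda>a b. 0) x"
proof -
  have "n \<ge> 1" "m \<ge> 1" using assms by (auto elim!: grid_arc_cases)
  then interpret orientable_map "toroidal_grid n m"
    by (rule toroidal_grid_orientable_map)
  have "tail (toroidal_grid n m) x \<in> grid_verts n m"
    using tail_in_verts[OF assms] by (simp add: toroidal_grid_simps)
  then have "Nhat (toroidal_grid n m) x w = (if w = tail (toroidal_grid n m) x then 1 / 2 else 0)"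
    by (simp add: Nhat_eq[OF assms] degree_toroidal_grid)
  also have "\<dots> = lift (torus_delta n m w) (\<lambda>a b. 0) x"
    using assms by (cases rule: grid_arc_cases) (auto simp: torus_delta_def toroidal_grid_simps)
  finally show ?thesis .
qed

text \<open>This reduces both claims to an identity between vertex functions; periodicity is the
  case \<open>v = u\<close>.\<close>

lemma U_pow_Nhat_toroidal_grid:
  assumes n: "n dvd 2" and k: "m dvd 2 * k" and x: "x \<in> arcs (toroidal_grid n m)"
    and eq: "\<And>a b. (-1) ^ k * (torus_delta n m u a b - row_avg (torus_delta n m u) a b)
      + row_avg (torus_delta n m u) a (b + int k) = torus_delta n m v a b"
  shows "mvec (arcs (toroidal_grid n m)) (mpow (arcs (toroidal_grid n m)) (U_mat (toroidal_grid n m)) k)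
      (\<lambda>y. Nhat (toroidal_grid n m) y u) x = Nhat (toroidal_grid n m) x v"
proof -
  let ?G = "toroidal_grid n m"
  have "mvec (arcs ?G) (mpow (arcs ?G) (U_mat ?G) k) (\<lambda>y. Nhat ?G y u) x
      = mvec (arcs ?G) (mpow (arcs ?G) (U_mat ?G) k) (lift (torus_delta n m u) (\<lambda>a b. 0)) x"
    by (intro fun_cong[OF mvec_cong] Nhat_toroidal_grid)
  also have "\<dots> = Nhat ?G x v"
    by (simp add: lift_U_pow_periodic[OF torus_periodic_delta n x k] eq Nhat_toroidal_grid[OF x])
  finally show ?thesis .
qed

lemma periodic_at_toroidal_gridI:
  assumes "n dvd 2" "m dvd 2 * k"
    and "\<And>u a b. (-1) ^ k * (torus_delta n m u a b - row_avg (torus_delta n m u) a b)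
      + row_avg (torus_delta n m u) a (b + int k) = torus_delta n m u a b"
  shows "periodic_at (toroidal_grid n m) k"
  using U_pow_Nhat_toroidal_grid[OF assms(1,2) _ assms(3)]
  by (simp add: periodic_at_def mmul_def mvec_def)

lemma perfect_state_transfer_toroidal_gridI:
  assumes "n dvd 2" "m dvd 2 * k"
    and uv: "u \<in> grid_verts n m" "v \<in> grid_verts n m" "u \<noteq> v"
    and "\<And>a b. (-1) ^ k * (torus_delta n m u a b - row_avg (torus_delta n m u) a b)
      + row_avg (torus_delta n m u) a (b + int k) = torus_delta n m v a b"
  shows "perfect_state_transfer (toroidal_grid n m) u v k"
proof -
  let ?G = "toroidal_grid n m"
  have "mvec (verts ?G) (Nhat ?G) (unit_vec w) = (\<lambda>y. Nhat ?G y w)" if "w \<in> grid_verts n m" for w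
    using that by (simp add: mvec_def unit_vec_def toroidal_grid_simps grid_verts_def
        if_distrib[of "\<lambda>t. _ * t"] cong: if_cong)
  then show ?thesis
    using uv U_pow_Nhat_toroidal_grid[OF assms(1,2) _ assms(6)]
    by (simp add: perfect_state_transfer_def degree_toroidal_grid toroidal_grid_simps)
qed

section \<open>Evaluation for one and for two rows\<close>

lemma row_avg_delta_1: "row_avg (torus_delta 1 m u) = torus_delta 1 m u"
  by (intro ext) (simp add: row_avg_def torus_delta_def)

lemma row_avg_delta_period:
  "row_avg (torus_delta n m u) a (b + int m) = row_avg (torus_delta n m u) a b"
  by (simp add: row_avg_def torus_delta_def)

lemma torus_delta_2_succ:
  assumes "i \<in> {0..<int m}"
  shows "torus_delta 2 m (0, i) (a + 1) b = torus_delta 2 m (1, i) a b"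
proof -
  have "(a + 1) mod 2 = 0 \<longleftrightarrow> a mod 2 = 1" by presburger
  then show ?thesis by (simp add: torus_delta_def)
qed

theorem theorem7p5:
  shows "(\<forall>m\<ge>1::nat.
            periodic_at (toroidal_grid 1 m) m \<and>
            (\<forall>l. m = 2 * l \<longrightarrow>
               (\<forall>i\<in>{0..<int m}.
                  perfect_state_transfer (toroidal_grid 1 m) (0, i) (0, (i + int l) mod int m) l))) \<and>
         (\<forall>m\<ge>1::nat.
            (even m \<longrightarrow> periodic_at (toroidal_grid 2 m) m) \<and>
            (odd m \<longrightarrow>
               (\<forall>i\<in>{0..<int m}. perfect_state_transfer (toroidal_grid 2 m) (0, i) (1, i) m) \<and>
               periodic_at (toroidal_grid 2 m) (2 * m)))"
proof (intro conjI allI impI ballI)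
  fix m :: nat assume "m \<ge> 1"
  \<comment> \<open>With one row \<open>p - e\<close> vanishes, and what remains is a shift by a
    full turn.\<close>
  show "periodic_at (toroidal_grid 1 m) m"
    by (rule periodic_at_toroidal_gridI) (simp_all add: row_avg_delta_1 torus_delta_def del: One_nat_def)
next
  fix m l :: nat and i :: int
  assume m: "m \<ge> 1" "m = 2 * l" and i: "i \<in> {0..<int m}"
  have shift: "(b + int l) mod int m = i \<longleftrightarrow> b mod int m = (i + int l) mod int m" for b
  proof -
    have "(b + int l) mod int m = i \<longleftrightarrow> (b + int l) mod int m = i mod int m"
      using i by simp
    also have "\<dots> \<longleftrightarrow> int m dvd b + int l - i"
      by (rule mod_eq_dvd_iff)
    \<comment> \<open>Since \<open>m = 2 * l\<close>, subtracting a full turn replaces the shift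
      \<open>+ l\<close> by \<open>- l\<close>.\<close>
    also have "\<dots> \<longleftrightarrow> int m dvd b + int l - i - int m"
      by (simp add: dvd_diff_left_iff)
    also have "\<dots> \<longleftrightarrow> int m dvd b - (i + int l)"
      using m by (simp add: algebra_simps)
    also have "\<dots> \<longleftrightarrow> b mod int m = (i + int l) mod int m"
      by (rule mod_eq_dvd_iff[symmetric])
    finally show ?thesis .
  qed
  have ne: "i \<noteq> (i + int l) mod int m"
  proof
    assume "i = (i + int l) mod int m"
    then have "(i + int l) mod int m = i mod int m" using i by simp
    then have "int m dvd int l" by (simp add: mod_eq_dvd_iff)
    \<comment> \<open>Here \<open>0 < l < m\<close>.\<close>
    then show False using m by (auto dest: zdvd_imp_le)
  qed
  show "perfect_state_transfer (toroidal_grid 1 m) (0, i) (0, (i + int l) mod int m) l"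
  proof (rule perfect_state_transfer_toroidal_gridI)
    show "(0, i) \<noteq> (0::int, (i + int l) mod int m)" using ne by simp
  next
    fix a b
    show "(-1) ^ l * (torus_delta 1 m (0, i) a b - row_avg (torus_delta 1 m (0, i)) a b)
        + row_avg (torus_delta 1 m (0, i)) a (b + int l)
        = torus_delta 1 m (0, (i + int l) mod int m) a b"
      by (simp add: row_avg_delta_1 torus_delta_def shift del: One_nat_def)
  qed (use m i in \<open>auto simp: grid_verts_def\<close>)
next
  fix m :: nat assume "m \<ge> 1" "even m"
  \<comment> \<open>The sign is 1 and the shift a full turn, so \<open>(p - e) + e\<close> gives
    back \<open>p\<close>.\<close>
  then show "periodic_at (toroidal_grid 2 m) m"
    by (intro periodic_at_toroidal_gridI) (simp_all add: row_avg_delta_period)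
next
  fix m :: nat and i :: int assume m: "m \<ge> 1" "odd m" and i: "i \<in> {0..<int m}"
  show "perfect_state_transfer (toroidal_grid 2 m) (0, i) (1, i) m"
  proof (rule perfect_state_transfer_toroidal_gridI)
    fix a b
    \<comment> \<open>The sign is -1, so the result is \<open>2 e - p\<close>, which is
      \<open>p\<close> with its two rows exchanged.\<close>
    show "(-1) ^ m * (torus_delta 2 m (0, i) a b - row_avg (torus_delta 2 m (0, i)) a b)
        + row_avg (torus_delta 2 m (0, i)) a (b + int m) = torus_delta 2 m (1, i) a b"
      unfolding row_avg_delta_period unfolding row_avg_def torus_delta_2_succ[OF i]
      using m(2) by (simp add: field_simps)
  qed (use i in \<open>auto simp: grid_verts_def\<close>)
next
  fix m :: nat assume "m \<ge> 1" "odd m"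
  \<comment> \<open>The shift now makes two full turns, and the sign is 1 because
    \<open>2 * m\<close> is even.\<close>
  have "row_avg (torus_delta 2 m u) a (b + int (2 * m)) = row_avg (torus_delta 2 m u) a b" for u a b
    using row_avg_delta_period[of 2 m u a "b + int m"] row_avg_delta_period[of 2 m u a b]
    by (simp add: algebra_simps)
  then show "periodic_at (toroidal_grid 2 m) (2 * m)"
    by (intro periodic_at_toroidal_gridI) (simp_all del: of_nat_mult)
qed

end
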